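(* (i) The reduction $\to_{\beta\eta\pi}$ is Church–Rosser. (ii) For all $\lambda$-terms $M,N$: $\Theta MN =_{\beta\eta\pi}\Omega$ if and only if $\lambda\pi\vdash M=N$.
   Context: $\Omega \equiv (\lambda x.xx)(\lambda x.xx)$, $B \equiv \lambda x.x(\lambda y.yx)$, $C \equiv \lambda z.zB$, $\Theta \equiv BC$. $\lambda\pi$ is the least $\lambda$-theory (congruence on $\lambda$-terms containing $\alpha\beta$-conversion) containing $\eta$-conversion and the equation $\Theta xx = \Omega$. Let $\mathcal{G}_\beta(\Theta)$ be the set of terms to which $\Theta$ reduces in zero or more $\beta$-steps. The $\pi$-reduction is given by $\Psi MN \to_\pi \Omega$ whenever $\Psi\in\mathcal{G}_\beta(\Theta)$ and $\lambda\pi\vdash M=N$. The reduction $\to_{\beta\eta\pi}$ is the contextual closure of the union of $\beta$-, $\eta$- and $\pi$-reduction, and $=_{\beta\eta\pi}$ is its reflexive, symmetric, transitive closure. *)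

theory Defs
  imports Main "HOL-Library.Confluence"
begin

text \<open>
  Lambda-terms modulo alpha-conversion are represented by de Bruijn terms: \<open>Var i\<close> refers to the
  \<open>i\<close>-th enclosing \<open>Lam\<close>, and indices exceeding the number of enclosing binders are the free
  variables. Alpha-conversion is therefore equality.
\<close>

datatype lam =
    Var nat
  | App lam lam (infixl \<open>\<degree>\<close> 200)
  | Lam lam

primrec lift :: "lam \<Rightarrow> nat \<Rightarrow> lam" where
  "lift (Var i) k = (if i < k then Var i else Var (i + 1))"
| "lift (s \<degree> t) k = lift s k \<degree> lift t k"
| "lift (Lam s) k = Lam (lift s (k + 1))"

text \<open>
  \<open>subst t s k\<close> replaces index \<open>k\<close> by \<open>s\<close> and decrements the larger indices, since the binder of
  \<open>k\<close> disappears.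
\<close>

primrec subst :: "lam \<Rightarrow> lam \<Rightarrow> nat \<Rightarrow> lam" where
  "subst (Var i) s k = (if k < i then Var (i - 1) else if i = k then s else Var i)"
| "subst (t \<degree> u) s k = subst t s k \<degree> subst u s k"
| "subst (Lam t) s k = Lam (subst t (lift s 0) (k + 1))"

inductive ctxt_closure :: "(lam \<Rightarrow> lam \<Rightarrow> bool) \<Rightarrow> lam \<Rightarrow> lam \<Rightarrow> bool"
  for R :: "lam \<Rightarrow> lam \<Rightarrow> bool" where
  base: "R s t \<Longrightarrow> ctxt_closure R s t"
| appL: "ctxt_closure R s t \<Longrightarrow> ctxt_closure R (s \<degree> u) (t \<degree> u)"
| appR: "ctxt_closure R s t \<Longrightarrow> ctxt_closure R (u \<degree> s) (u \<degree> t)"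
| lam: "ctxt_closure R s t \<Longrightarrow> ctxt_closure R (Lam s) (Lam t)"

inductive beta_rule :: "lam \<Rightarrow> lam \<Rightarrow> bool" where
  "beta_rule (Lam s \<degree> t) (subst s t 0)"

text \<open>Lifting \<open>s\<close> expresses that the abstracted variable is not free in it.\<close>

inductive eta_rule :: "lam \<Rightarrow> lam \<Rightarrow> bool" where
  "eta_rule (Lam (lift s 0 \<degree> Var 0)) s"

definition beta :: "lam \<Rightarrow> lam \<Rightarrow> bool" where
  "beta = ctxt_closure beta_rule"

definition eta :: "lam \<Rightarrow> lam \<Rightarrow> bool" where
  "eta = ctxt_closure eta_rule"

definition Omega :: lam where
  "Omega = Lam (Var 0 \<degree> Var 0) \<degree> Lam (Var 0 \<degree> Var 0)"

definition B_term :: lam where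
  "B_term = Lam (Var 0 \<degree> Lam (Var 0 \<degree> Var 1))"

definition C_term :: lam where
  "C_term = Lam (Var 0 \<degree> B_term)"

definition Theta :: lam where
  "Theta = B_term \<degree> C_term"

definition lambda_theory :: "(lam \<Rightarrow> lam \<Rightarrow> bool) \<Rightarrow> bool" where
  "lambda_theory T \<longleftrightarrow>
     equivp T \<and>
     (\<forall>M M' N N'. T M M' \<longrightarrow> T N N' \<longrightarrow> T (M \<degree> N) (M' \<degree> N')) \<and>
     (\<forall>M N. T M N \<longrightarrow> T (Lam M) (Lam N)) \<and>
     equivclp beta \<le> T"

definition pi_theory :: "(lam \<Rightarrow> lam \<Rightarrow> bool) \<Rightarrow> bool" where
  "pi_theory T \<longleftrightarrow>
     lambda_theory T \<and> equivclp eta \<le> T \<and> (\<forall>i. T (Theta \<degree> Var i \<degree> Var i) Omega)"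

definition lambda_pi :: "lam \<Rightarrow> lam \<Rightarrow> bool" where
  "lambda_pi M N \<longleftrightarrow> (\<forall>T. pi_theory T \<longrightarrow> T M N)"

lemma pi_theory_lambda_pi: "pi_theory lambda_pi"
  unfolding pi_theory_def [of lambda_pi] lambda_theory_def [of lambda_pi]
proof (intro conjI)
  have eq: "equivp T" if "pi_theory T" for T
    using that by (simp add: pi_theory_def lambda_theory_def)
  show "equivp lambda_pi"
  proof (rule equivpI)
    show "reflp lambda_pi"
      by (intro reflpI) (auto simp: lambda_pi_def intro: equivp_reflp [OF eq])
    show "symp lambda_pi"
      by (intro sympI) (metis lambda_pi_def eq equivp_symp)
    show "transp lambda_pi"
      by (intro transpI) (metis lambda_pi_def eq equivp_transp)
  qed
  have "T (M \<degree> N) (M' \<degree> N')" if "pi_theory T" "T M M'" "T N N'" for T M M' N N'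
    using that by (simp add: pi_theory_def lambda_theory_def)
  then show "\<forall>M M' N N'. lambda_pi M M' \<longrightarrow> lambda_pi N N' \<longrightarrow> lambda_pi (M \<degree> N) (M' \<degree> N')"
    by (metis lambda_pi_def)
  have "T (Lam M) (Lam N)" if "pi_theory T" "T M N" for T M N
    using that by (simp add: pi_theory_def lambda_theory_def)
  then show "\<forall>M N. lambda_pi M N \<longrightarrow> lambda_pi (Lam M) (Lam N)"
    by (metis lambda_pi_def)
qed (auto simp: lambda_pi_def pi_theory_def lambda_theory_def le_fun_def)

lemma lambda_pi_least: "pi_theory T \<Longrightarrow> lambda_pi \<le> T"
  unfolding le_fun_def le_bool_def lambda_pi_def by metis

definition G_beta :: "lam \<Rightarrow> lam set" where
  "G_beta M = {P. beta\<^sup>*\<^sup>* M P}"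

inductive pi_rule :: "lam \<Rightarrow> lam \<Rightarrow> bool" where
  "\<Psi> \<in> G_beta Theta \<Longrightarrow> lambda_pi M N \<Longrightarrow> pi_rule (\<Psi> \<degree> M \<degree> N) Omega"

definition beta_eta_pi :: "lam \<Rightarrow> lam \<Rightarrow> bool" where
  "beta_eta_pi = ctxt_closure (sup beta_rule (sup eta_rule pi_rule))"

end

theory Submission
  imports Defs
begin

text \<open>
  Three closed terms make up \<open>G_beta Theta\<close>; they form a reduction cycle and contain no other redex.
  As \<open>\<lambda>\<pi>\<close> contains the reduction and is stable under substitution, \<open>\<pi>\<close>-redexes stay \<open>\<pi>\<close>-redexes
  under reduction and substitution, and Takahashi's method gives confluence: all parallel reducts of a
  term reduce to its complete development. There is one dangerous overlap: \<open>\<lambda>x. \<Psi> M x\<close>, with \<open>x\<close> not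
  free in \<open>M\<close>, \<open>\<eta>\<close>-reduces to \<open>\<Psi> M\<close> and, if \<open>\<lambda>\<pi>\<close> proves \<open>M = x\<close>, also \<open>\<pi>\<close>-reduces to \<open>\<lambda>x. \<Omega>\<close>. This
  cannot happen since \<open>\<lambda>\<pi>\<close> is consistent: it is contained in the conversion of a reduction that
  contracts to \<open>\<Omega>\<close> every term obtained from \<open>\<Omega>\<close> or an element of \<open>G_beta Theta\<close> by applying to
  arguments and abstracting. The same argument shows that this reduction is confluent, and variables are
  normal forms of it. Both reductions are treated at once by contracting an arbitrary set \<open>P\<close> of terms
  to \<open>\<Omega>\<close>.
\<close>

section \<open>Lifting, substitution and free variables\<close>

lemma lift_lift: "i \<le> k \<Longrightarrow> lift (lift t i) (Suc k) = lift (lift t k) i"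
  by (induct t arbitrary: i k) auto

lemma lift_subst: "j \<le> i \<Longrightarrow> lift (subst t s j) i = subst (lift t (Suc i)) (lift s i) j"
  by (induct t arbitrary: i j s) (auto simp: lift_lift)

lemma lift_subst_ge: "i \<le> j \<Longrightarrow> lift (subst t s j) i = subst (lift t i) (lift s i) (Suc j)"
  by (induct t arbitrary: i j s) (auto simp: lift_lift)

lemma subst_lift [simp]: "subst (lift t k) s k = t"
  by (induct t arbitrary: k s) auto

lemma subst_lift_Suc_Var [simp]: "subst (lift t (Suc k)) (Var k) k = t"
  by (induct t arbitrary: k) auto

lemma subst_subst:
  "i \<le> j \<Longrightarrow> subst (subst t (lift v i) (Suc j)) (subst u v j) i = subst (subst t u i) v j"
proof (induct t arbitrary: i j u v)
  case (Lam t)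
  then show ?case
    by (simp add: lift_lift [symmetric] lift_subst_ge)
qed auto

lemma size_lift [simp]: "size (lift t k) = size t"
  by (induct t arbitrary: k) auto

lemma lift_inject [simp]: "lift s k = lift t k \<longleftrightarrow> s = t"
  by (metis subst_lift)

lemma lift_eq_App_iff: "lift s k = t \<degree> u \<longleftrightarrow> (\<exists>t' u'. s = t' \<degree> u' \<and> t = lift t' k \<and> u = lift u' k)"
  by (cases s) auto

lemma lift_eq_Lam_iff: "lift s k = Lam t \<longleftrightarrow> (\<exists>t'. s = Lam t' \<and> t = lift t' (Suc k))"
  by (cases s) auto

lemma lift_neq_Var [simp]: "lift s k \<noteq> Var k" "Var k \<noteq> lift s k"
  by (cases s; auto)+

lemma lift_Omega [simp]: "lift Omega k = Omega"
  and subst_Omega [simp]: "subst Omega s k = Omega"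
  by (simp_all add: Omega_def)

lemma subst_Theta [simp]: "subst Theta s k = Theta"
  by (simp add: Theta_def B_term_def C_term_def)

definition fresh :: "nat \<Rightarrow> lam \<Rightarrow> bool" where
  "fresh k s \<longleftrightarrow> (\<exists>r. s = lift r k)"

lemma fresh_lift [simp]: "fresh k (lift s k)"
  by (auto simp: fresh_def)

lemma fresh_Var_iff [simp]: "fresh k (Var i) \<longleftrightarrow> i \<noteq> k"
proof
  show "fresh k (Var i)" if "i \<noteq> k"
    unfolding fresh_def using that
    by (intro exI [of _ "Var (if i < k then i else i - 1)"]) auto
qed (auto simp: fresh_def)

lemma fresh_App_iff [simp]: "fresh k (s \<degree> t) \<longleftrightarrow> fresh k s \<and> fresh k t"
  by (auto simp: fresh_def eq_commute [of "_ \<degree> _"] lift_eq_App_iff)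

lemma fresh_Lam_iff [simp]: "fresh k (Lam s) \<longleftrightarrow> fresh (Suc k) s"
  by (auto simp: fresh_def eq_commute [of "Lam _"] lift_eq_Lam_iff)

lemma fresh_subst: "fresh (Suc k) s \<Longrightarrow> fresh k t \<Longrightarrow> i \<le> k \<Longrightarrow> fresh k (subst s t i)"
  by (auto simp: fresh_def simp flip: lift_subst)

lemma fresh_Suc_lift_iff [simp]:
  assumes "i \<le> k"
  shows "fresh (Suc k) (lift s i) \<longleftrightarrow> fresh k s"
proof
  assume "fresh (Suc k) (lift s i)"
  then have "fresh k (subst (lift s i) (Var (Suc k)) i)"
    by (rule fresh_subst) (use assms in auto)
  then show "fresh k s"
    by simp
next
  assume "fresh k s"
  with assms show "fresh (Suc k) (lift s i)"
    by (auto simp: fresh_def simp flip: lift_lift)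
qed

section \<open>Conversion, contextual closure and congruences\<close>

lemma confluentp_equivclpE:
  assumes "confluentp r" "equivclp r x y"
  obtains u where "r\<^sup>*\<^sup>* x u" "r\<^sup>*\<^sup>* y u"
proof -
  have "(r\<^sup>*\<^sup>* OO r\<inverse>\<inverse>\<^sup>*\<^sup>*) x y"
    using assms by (simp only: semiconfluentp_equivclp confluentp_eq_semiconfluentp)
  then show thesis
    by (auto simp: rtranclp_conversep intro: that)
qed

lemma ctxt_closure_Var_iff: "ctxt_closure R (Var i) t \<longleftrightarrow> R (Var i) t"
  by (subst ctxt_closure.simps) auto

lemma ctxt_closure_App_iff:
  "ctxt_closure R (s \<degree> t) u \<longleftrightarrow> R (s \<degree> t) u \<or>
     (\<exists>s'. ctxt_closure R s s' \<and> u = s' \<degree> t) \<or> (\<exists>t'. ctxt_closure R t t' \<and> u = s \<degree> t')"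
  by (subst ctxt_closure.simps) auto

lemma ctxt_closure_Lam_iff:
  "ctxt_closure R (Lam s) u \<longleftrightarrow> R (Lam s) u \<or> (\<exists>s'. ctxt_closure R s s' \<and> u = Lam s')"
  by (subst ctxt_closure.simps) auto

lemmas ctxt_closure_iff = ctxt_closure_Var_iff ctxt_closure_App_iff ctxt_closure_Lam_iff

lemma rtranclp_ctxt_closure_App:
  assumes "(ctxt_closure R)\<^sup>*\<^sup>* s s'" "(ctxt_closure R)\<^sup>*\<^sup>* t t'"
  shows "(ctxt_closure R)\<^sup>*\<^sup>* (s \<degree> t) (s' \<degree> t')"
proof -
  have "(ctxt_closure R)\<^sup>*\<^sup>* (s \<degree> t) (s' \<degree> t)"
    using assms(1) by induct (auto intro: ctxt_closure.appL rtranclp.rtrancl_into_rtrancl)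
  also have "(ctxt_closure R)\<^sup>*\<^sup>* (s' \<degree> t) (s' \<degree> t')"
    using assms(2) by induct (auto intro: ctxt_closure.appR rtranclp.rtrancl_into_rtrancl)
  finally show ?thesis .
qed

lemma rtranclp_ctxt_closure_Lam:
  "(ctxt_closure R)\<^sup>*\<^sup>* s s' \<Longrightarrow> (ctxt_closure R)\<^sup>*\<^sup>* (Lam s) (Lam s')"
  by (induct rule: rtranclp_induct) (auto intro: ctxt_closure.lam rtranclp.rtrancl_into_rtrancl)

lemma ctxt_closure_mono: "R \<le> R' \<Longrightarrow> ctxt_closure R \<le> ctxt_closure R'"
proof (rule predicate2I)
  show "ctxt_closure R' s t" if "ctxt_closure R s t" "R \<le> R'" for s t
    using that by induct (auto intro: ctxt_closure.intros)
qed

lemma symclp_ctxt_closure: "symclp (ctxt_closure R) = ctxt_closure (symclp R)"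
proof (intro antisym predicate2I)
  have "ctxt_closure (symclp R) t s" if "ctxt_closure R s t" for s t
    using that by induct (auto intro: ctxt_closure.intros)
  then show "ctxt_closure (symclp R) s t" if "symclp (ctxt_closure R) s t" for s t
    using that ctxt_closure_mono [OF symclp_greater [of R]] by (auto elim: symclpE)
  show "symclp (ctxt_closure R) s t" if "ctxt_closure (symclp R) s t" for s t
    using that by induct (auto simp: symclp_def intro: ctxt_closure.intros)
qed

definition lam_congruence :: "(lam \<Rightarrow> lam \<Rightarrow> bool) \<Rightarrow> bool" where
  "lam_congruence T \<longleftrightarrow>
     equivp T \<and>
     (\<forall>M M' N N'. T M M' \<longrightarrow> T N N' \<longrightarrow> T (M \<degree> N) (M' \<degree> N')) \<and>
     (\<forall>M N. T M N \<longrightarrow> T (Lam M) (Lam N))"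

lemma lam_congruence_equivclp_ctxt_closure: "lam_congruence (equivclp (ctxt_closure R))"
proof -
  have "equivclp (ctxt_closure R) = (ctxt_closure (symclp R))\<^sup>*\<^sup>*"
    by (simp add: equivclp_def symclp_ctxt_closure)
  with equivp_evquivclp [of "ctxt_closure R"] show ?thesis
    by (simp add: lam_congruence_def rtranclp_ctxt_closure_App rtranclp_ctxt_closure_Lam)
qed

lemma equivclp_ctxt_closure_le_iff:
  assumes "lam_congruence T"
  shows "equivclp (ctxt_closure R) \<le> T \<longleftrightarrow> R \<le> T"
proof
  assume "equivclp (ctxt_closure R) \<le> T"
  then show "R \<le> T"
    by (auto intro: ctxt_closure.base)
next
  assume "R \<le> T"
  have equivp: "equivp T"
    using assms by (simp add: lam_congruence_def)
  have closure: "T s t" if "ctxt_closure R s t" for s t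
    using that
    by induct (use assms \<open>R \<le> T\<close> equivp_reflp [OF equivp] in \<open>auto simp: lam_congruence_def\<close>)
  show "equivclp (ctxt_closure R) \<le> T"
  proof (rule predicate2I)
    fix s t
    assume "equivclp (ctxt_closure R) s t"
    then show "T s t"
      by (induct rule: equivclp_induct)
        (use equivp closure in \<open>blast intro: equivp_reflp equivp_symp equivp_transp\<close>)+
  qed
qed

lemma pi_theory_iff:
  "pi_theory T \<longleftrightarrow> lam_congruence T \<and> beta_rule \<le> T \<and> eta_rule \<le> T \<and>
     (\<forall>i. T (Theta \<degree> Var i \<degree> Var i) Omega)"
proof -
  have "pi_theory T \<longleftrightarrow> lam_congruence T \<and> equivclp beta \<le> T \<and> equivclp eta \<le> T \<and>
      (\<forall>i. T (Theta \<degree> Var i \<degree> Var i) Omega)"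
    by (auto simp: pi_theory_def lambda_theory_def lam_congruence_def)
  then show ?thesis
    using equivclp_ctxt_closure_le_iff [of T] by (auto simp only: beta_def eta_def)
qed

section \<open>\<open>\<beta>\<eta>\<close>-reduction with contraction to \<open>\<Omega>\<close>\<close>

definition beta_eta_Omega :: "lam set \<Rightarrow> lam \<Rightarrow> lam \<Rightarrow> bool" where
  "beta_eta_Omega P = ctxt_closure (sup beta_rule (sup eta_rule (\<lambda>s t. s \<in> P \<and> t = Omega)))"

lemma beta_eta_Omega_Var_iff: "beta_eta_Omega P (Var i) t \<longleftrightarrow> Var i \<in> P \<and> t = Omega"
  by (simp add: beta_eta_Omega_def ctxt_closure_Var_iff beta_rule.simps eta_rule.simps)

lemma beta_eta_Omega_App_iff:
  "beta_eta_Omega P (s \<degree> t) u \<longleftrightarrow>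
     (\<exists>r. s = Lam r \<and> u = subst r t 0) \<or> s \<degree> t \<in> P \<and> u = Omega \<or>
     (\<exists>s'. beta_eta_Omega P s s' \<and> u = s' \<degree> t) \<or> (\<exists>t'. beta_eta_Omega P t t' \<and> u = s \<degree> t')"
  by (auto simp: beta_eta_Omega_def ctxt_closure_App_iff beta_rule.simps eta_rule.simps)

lemma beta_eta_Omega_Lam_iff:
  "beta_eta_Omega P (Lam s) u \<longleftrightarrow>
     s = lift u 0 \<degree> Var 0 \<or> Lam s \<in> P \<and> u = Omega \<or> (\<exists>s'. beta_eta_Omega P s s' \<and> u = Lam s')"
  by (auto simp: beta_eta_Omega_def ctxt_closure_Lam_iff beta_rule.simps eta_rule.simps)

lemmas beta_eta_Omega_iff =
  beta_eta_Omega_Var_iff beta_eta_Omega_App_iff beta_eta_Omega_Lam_iff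

lemma beta_eta_Omega_contract: "s \<in> P \<Longrightarrow> beta_eta_Omega P s Omega"
  by (simp add: beta_eta_Omega_def ctxt_closure.base)

lemma rtranclp_beta_eta_Omega_App:
  "(beta_eta_Omega P)\<^sup>*\<^sup>* s s' \<Longrightarrow> (beta_eta_Omega P)\<^sup>*\<^sup>* t t' \<Longrightarrow>
    (beta_eta_Omega P)\<^sup>*\<^sup>* (s \<degree> t) (s' \<degree> t')"
  unfolding beta_eta_Omega_def by (rule rtranclp_ctxt_closure_App)

lemma rtranclp_beta_eta_Omega_Lam:
  "(beta_eta_Omega P)\<^sup>*\<^sup>* s s' \<Longrightarrow> (beta_eta_Omega P)\<^sup>*\<^sup>* (Lam s) (Lam s')"
  unfolding beta_eta_Omega_def by (rule rtranclp_ctxt_closure_Lam)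

lemma pi_theory_equivclp_beta_eta_Omega:
  assumes "\<And>i. Theta \<degree> Var i \<degree> Var i \<in> P"
  shows "pi_theory (equivclp (beta_eta_Omega P))"
proof -
  have "sup beta_rule eta_rule \<le> equivclp (beta_eta_Omega P)"
    by (auto simp: beta_eta_Omega_def intro!: r_into_equivclp ctxt_closure.base)
  then show ?thesis
    using assms lam_congruence_equivclp_ctxt_closure
    by (auto simp: pi_theory_iff beta_eta_Omega_def intro: r_into_equivclp ctxt_closure.base)
qed

text \<open>
  The last two conditions resolve the overlaps of a contraction with an enclosing \<open>\<beta>\<close>- or
  \<open>\<eta>\<close>-redex; for \<open>\<pi>\<close>-reduction they hold vacuously.
\<close>

locale Omega_contraction =
  fixes P :: "lam set"
  assumes lift_mem: "s \<in> P \<Longrightarrow> lift s k \<in> P"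
    and subst_mem: "s \<in> P \<Longrightarrow> subst s t k \<in> P"
    and beta_eta_Omega_mem: "s \<in> P \<Longrightarrow> beta_eta_Omega P s t \<Longrightarrow> t \<in> P"
    and Var_notin: "Var i \<notin> P"
    and beta_redex_mem: "Lam s \<in> P \<Longrightarrow> Lam s \<degree> t \<in> P"
    and eta_redex_mem: "lift s 0 \<degree> Var 0 \<in> P \<Longrightarrow> Lam (lift s 0 \<degree> Var 0) \<in> P"
begin

inductive par :: "lam \<Rightarrow> lam \<Rightarrow> bool" (infix \<open>\<rightrightarrows>\<close> 50) where
  Var: "Var i \<rightrightarrows> Var i"
| App: "s \<rightrightarrows> s' \<Longrightarrow> t \<rightrightarrows> t' \<Longrightarrow> s \<degree> t \<rightrightarrows> s' \<degree> t'"
| Lam: "s \<rightrightarrows> s' \<Longrightarrow> Lam s \<rightrightarrows> Lam s'"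
| beta: "s \<rightrightarrows> s' \<Longrightarrow> t \<rightrightarrows> t' \<Longrightarrow> Lam s \<degree> t \<rightrightarrows> subst s' t' 0"
| eta: "s \<rightrightarrows> s' \<Longrightarrow> Lam (lift s 0 \<degree> Var 0) \<rightrightarrows> s'"
| Omega: "s \<in> P \<Longrightarrow> s \<rightrightarrows> Omega"

lemma par_refl [simp]: "s \<rightrightarrows> s"
  by (induct s) (auto intro: par.intros)

lemma beta_eta_Omega_imp_par:
  assumes "beta_eta_Omega P s t"
  shows "s \<rightrightarrows> t"
  using assms unfolding beta_eta_Omega_def
  by (induct rule: ctxt_closure.induct) (auto simp: beta_rule.simps eta_rule.simps intro: par.intros)

lemma par_imp_rtranclp_beta_eta_Omega:
  assumes "s \<rightrightarrows> t"
  shows "(beta_eta_Omega P)\<^sup>*\<^sup>* s t"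
  using assms
proof induct
  case (beta s s' t t')
  then have "(beta_eta_Omega P)\<^sup>*\<^sup>* (Lam s \<degree> t) (Lam s' \<degree> t')"
    by (intro rtranclp_beta_eta_Omega_App rtranclp_beta_eta_Omega_Lam)
  then show ?case
    by (rule rtranclp.rtrancl_into_rtrancl) (simp add: beta_eta_Omega_App_iff)
next
  case (eta s s')
  have "beta_eta_Omega P (Lam (lift s 0 \<degree> Var 0)) s"
    by (simp add: beta_eta_Omega_Lam_iff)
  with eta show ?case
    by (simp add: converse_rtranclp_into_rtranclp)
qed (auto intro: rtranclp_beta_eta_Omega_App rtranclp_beta_eta_Omega_Lam beta_eta_Omega_contract)

lemma par_mem:
  assumes "s \<rightrightarrows> t" "s \<in> P"
  shows "t \<in> P"
  using par_imp_rtranclp_beta_eta_Omega [OF assms(1)] assms(2)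
  by induct (auto intro: beta_eta_Omega_mem)

lemma par_lift: "s \<rightrightarrows> t \<Longrightarrow> lift s k \<rightrightarrows> lift t k"
proof (induct arbitrary: k rule: par.induct)
  case (eta s s')
  then have "Lam (lift (lift s k) 0 \<degree> Var 0) \<rightrightarrows> lift s' k"
    by (intro par.eta)
  then show ?case
    by (simp add: lift_lift)
qed (auto simp: lift_subst intro: par.intros lift_mem)

lemma par_subst:
  assumes "s \<rightrightarrows> s'" "t \<rightrightarrows> t'"
  shows "subst s t k \<rightrightarrows> subst s' t' k"
  using assms
proof (induct arbitrary: t t' k rule: par.induct)
  case (beta r r' s s')
  then have "Lam (subst r (lift t 0) (Suc k)) \<degree> subst s t k
      \<rightrightarrows> subst (subst r' (lift t' 0) (Suc k)) (subst s' t' k) 0"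
    by (intro par.beta) (auto intro: par_lift)
  then show ?case
    by (simp add: subst_subst)
next
  case (eta s s')
  then have "Lam (lift (subst s t k) 0 \<degree> Var 0) \<rightrightarrows> subst s' t' k"
    by (intro par.eta) auto
  then show ?case
    by (simp add: lift_subst_ge)
next
  case (Lam s s')
  then show ?case
    by (simp add: par.Lam par_lift)
qed (auto intro: par.intros par_lift subst_mem)

lemma par_fresh: "s \<rightrightarrows> t \<Longrightarrow> fresh k s \<Longrightarrow> fresh k t"
proof (induct arbitrary: k rule: par.induct)
  case (Omega s)
  show ?case
    by (metis fresh_lift lift_Omega)
qed (auto intro: fresh_subst)

lemma par_liftE:
  assumes "lift s k \<rightrightarrows> t"
  obtains t' where "t = lift t' k" "s \<rightrightarrows> t'"
proof -
  have "fresh k t"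
    using assms fresh_lift by (rule par_fresh)
  then obtain t' where t_eq: "t = lift t' k"
    unfolding fresh_def ..
  have "subst (lift s k) (Var k) k \<rightrightarrows> subst (lift t' k) (Var k) k"
    using assms unfolding t_eq by (rule par_subst) simp
  with t_eq that show thesis
    by simp
qed

lemma par_VarD: "Var i \<rightrightarrows> t \<Longrightarrow> t = Var i"
  using Var_notin by (auto elim: par.cases)

lemma par_AppE:
  assumes "s \<degree> t \<rightrightarrows> u"
  obtains (App) s' t' where "u = s' \<degree> t'" "s \<rightrightarrows> s'" "t \<rightrightarrows> t'"
    | (beta) r r' t' where "s = Lam r" "u = subst r' t' 0" "r \<rightrightarrows> r'" "t \<rightrightarrows> t'"
    | (Omega) "s \<degree> t \<in> P"
  using assms by cases auto

lemma par_LamE: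
  assumes "Lam s \<rightrightarrows> u"
  obtains (Lam) s' where "u = Lam s'" "s \<rightrightarrows> s'"
    | (eta) r where "s = lift r 0 \<degree> Var 0" "r \<rightrightarrows> u"
    | (Omega) "Lam s \<in> P"
  using assms by cases auto

lemma par_eta_bodyE:
  assumes "lift s 0 \<degree> Var 0 \<rightrightarrows> t"
  obtains (App) s' where "t = lift s' 0 \<degree> Var 0" "s \<rightrightarrows> s'"
    | (beta) r where "s = Lam r" "r \<rightrightarrows> t"
    | (Omega) "lift s 0 \<degree> Var 0 \<in> P"
  using assms
proof (cases rule: par_AppE)
  case (App u v)
  then have "t = u \<degree> Var 0"
    by (auto dest: par_VarD)
  moreover obtain s' where "u = lift s' 0" "s \<rightrightarrows> s'"
    using App(2) by (rule par_liftE)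
  ultimately show thesis
    using that(1) by simp
next
  case (beta q q' v)
  from beta(1) obtain r where s_eq: "s = Lam r" and q_eq: "q = lift r (Suc 0)"
    by (auto simp: lift_eq_Lam_iff)
  from beta(3) obtain r' where "q' = lift r' (Suc 0)" "r \<rightrightarrows> r'"
    unfolding q_eq by (rule par_liftE)
  moreover have "v = Var 0"
    using beta(4) by (rule par_VarD)
  ultimately have "r \<rightrightarrows> t"
    using beta(2) by simp
  with s_eq show thesis
    by (rule that(2))
qed (rule that(3))

definition complete_development :: "lam \<Rightarrow> lam \<Rightarrow> bool" where
  "complete_development s u \<longleftrightarrow> (\<forall>t. s \<rightrightarrows> t \<longrightarrow> t \<rightrightarrows> u)"

lemma complete_developmentI: "(\<And>t. s \<rightrightarrows> t \<Longrightarrow> t \<rightrightarrows> u) \<Longrightarrow> complete_development s u"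
  by (simp add: complete_development_def)

lemma complete_developmentD: "complete_development s u \<Longrightarrow> s \<rightrightarrows> t \<Longrightarrow> t \<rightrightarrows> u"
  by (simp add: complete_development_def)

lemma complete_development_Omega: "s \<in> P \<Longrightarrow> complete_development s Omega"
  by (blast intro: complete_developmentI par.Omega par_mem)

lemma complete_development_Var: "complete_development (Var i) (Var i)"
  by (rule complete_developmentI) (auto dest: par_VarD)

lemma complete_development_App:
  assumes "s \<degree> t \<notin> P" "\<And>r. s \<noteq> Lam r" "complete_development s u" "complete_development t v"
  shows "complete_development (s \<degree> t) (u \<degree> v)"
proof (rule complete_developmentI)
  show "w \<rightrightarrows> u \<degree> v" if "s \<degree> t \<rightrightarrows> w" for w
    using that by (cases rule: par_AppE) (use assms in \<open>auto intro: par.App complete_developmentD\<close>)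
qed

lemma complete_development_beta:
  assumes not_mem: "Lam s \<degree> t \<notin> P"
    and dev_s: "complete_development s u" and dev_t: "complete_development t v"
  shows "complete_development (Lam s \<degree> t) (subst u v 0)"
proof (rule complete_developmentI)
  fix w
  assume "Lam s \<degree> t \<rightrightarrows> w"
  then show "w \<rightrightarrows> subst u v 0"
  proof (cases rule: par_AppE)
    case (App r t')
    have par_t': "t' \<rightrightarrows> v"
      using dev_t App(3) by (rule complete_developmentD)
    from App(2) show ?thesis
    proof (cases rule: par_LamE)
      case (Lam s')
      with App(1) par_t' dev_s show ?thesis
        by (auto intro: par.beta complete_developmentD)
    next
      case (eta q)
      then have "s \<rightrightarrows> lift r 0 \<degree> Var 0"
        by (simp add: par.App par_lift)
      with dev_s have "lift r 0 \<degree> Var 0 \<rightrightarrows> u"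
        by (rule complete_developmentD)
      from par_subst [OF this par_t', of 0] App(1) show ?thesis
        by simp
    qed (use beta_redex_mem not_mem in blast)
  next
    case (beta s' t')
    with dev_s dev_t show ?thesis
      by (auto intro: par_subst complete_developmentD)
  qed (use not_mem in contradiction)
qed

lemma complete_development_Lam:
  assumes "Lam s \<notin> P" "\<And>r. s \<noteq> lift r 0 \<degree> Var 0" "complete_development s u"
  shows "complete_development (Lam s) (Lam u)"
proof (rule complete_developmentI)
  show "t \<rightrightarrows> Lam u" if "Lam s \<rightrightarrows> t" for t
    using that by (cases rule: par_LamE) (use assms in \<open>auto intro: par.Lam complete_developmentD\<close>)
qed

lemma complete_development_eta:
  assumes not_mem: "Lam (lift s 0 \<degree> Var 0) \<notin> P" and dev_s: "complete_development s u"
  shows "complete_development (Lam (lift s 0 \<degree> Var 0)) u"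
proof (rule complete_developmentI)
  fix t
  assume "Lam (lift s 0 \<degree> Var 0) \<rightrightarrows> t"
  then show "t \<rightrightarrows> u"
  proof (cases rule: par_LamE)
    case (Lam r)
    from Lam(2) show ?thesis
    proof (cases rule: par_eta_bodyE)
      case (App s')
      with Lam(1) dev_s show ?thesis
        by (auto intro: par.eta complete_developmentD)
    next
      case (beta q)
      with Lam(1) dev_s show ?thesis
        by (auto intro: par.Lam complete_developmentD)
    qed (use eta_redex_mem not_mem in blast)
  next
    case (eta r)
    with dev_s show ?thesis
      by (auto intro: complete_developmentD)
  qed (use not_mem in contradiction)
qed

lemma ex_complete_development: "\<exists>u. complete_development s u"
proof (induct s rule: measure_induct_rule [of size])
  case (less s)
  consider "s \<in> P" | i where "s = Var i"
    | (App) t r where "s \<notin> P" "s = t \<degree> r" "\<And>q. t \<noteq> Lam q"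
    | (beta) t r where "s \<notin> P" "s = Lam t \<degree> r"
    | (Lam) t where "s \<notin> P" "s = Lam t" "\<And>r. t \<noteq> lift r 0 \<degree> Var 0"
    | (eta) t where "s \<notin> P" "s = Lam (lift t 0 \<degree> Var 0)"
    by (metis lam.exhaust)
  then show ?case
  proof cases
    case (App t r)
    with less [of t] less [of r] show ?thesis
      by (auto intro: complete_development_App)
  next
    case (beta t r)
    with less [of t] less [of r] show ?thesis
      by (auto intro: complete_development_beta)
  next
    case (Lam t)
    with less [of t] show ?thesis
      by (auto intro: complete_development_Lam)
  next
    case (eta t)
    with less [of t] show ?thesis
      by (auto intro: complete_development_eta)
  qed (auto intro: complete_development_Omega complete_development_Var)
qed

lemma par_diamond: "s \<rightrightarrows> t \<Longrightarrow> s \<rightrightarrows> u \<Longrightarrow> \<exists>v. t \<rightrightarrows> v \<and> u \<rightrightarrows> v"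
  using ex_complete_development complete_developmentD by blast

lemma confluentp_beta_eta_Omega: "confluentp (beta_eta_Omega P)"
proof -
  have "par\<^sup>*\<^sup>* = (beta_eta_Omega P)\<^sup>*\<^sup>*"
    by (rule rtranclp_subset) (auto intro: beta_eta_Omega_imp_par par_imp_rtranclp_beta_eta_Omega)
  moreover have "strong_confluentp par"
    by (rule strong_confluentpI) (use par_diamond in blast)
  then have "confluentp par"
    by (rule strong_confluentp_imp_confluentp)
  ultimately show ?thesis
    by (simp add: confluentp_conv_strong_confluentp_rtranclp)
qed

end

section \<open>The theory \<open>\<lambda>\<pi>\<close>\<close>

lemma lam_congruence_lambda_pi: "lam_congruence lambda_pi"
  and beta_rule_lambda_pi: "beta_rule \<le> lambda_pi"
  and eta_rule_lambda_pi: "eta_rule \<le> lambda_pi"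
  and lambda_pi_Theta_Var: "lambda_pi (Theta \<degree> Var i \<degree> Var i) Omega"
  using pi_theory_lambda_pi by (simp_all add: pi_theory_iff)

lemma equivp_lambda_pi: "equivp lambda_pi"
  and lambda_pi_App: "lambda_pi M M' \<Longrightarrow> lambda_pi N N' \<Longrightarrow> lambda_pi (M \<degree> N) (M' \<degree> N')"
  and lambda_pi_Lam: "lambda_pi M N \<Longrightarrow> lambda_pi (Lam M) (Lam N)"
  using lam_congruence_lambda_pi by (simp_all add: lam_congruence_def)

lemmas lambda_pi_refl [simp] = equivp_reflp [OF equivp_lambda_pi]
  and lambda_pi_sym = equivp_symp [OF equivp_lambda_pi]
  and lambda_pi_trans [trans] = equivp_transp [OF equivp_lambda_pi]

lemma lambda_pi_beta: "lambda_pi (Lam s \<degree> t) (subst s t 0)"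
  using beta_rule_lambda_pi beta_rule.intros by blast

lemma lambda_pi_eta: "lambda_pi (Lam (lift s 0 \<degree> Var 0)) s"
  using eta_rule_lambda_pi eta_rule.intros by blast

lemma lambda_pi_Theta: "lambda_pi (Theta \<degree> M \<degree> M) Omega"
proof -
  have "lambda_pi (Theta \<degree> M \<degree> M) (Lam (Theta \<degree> Var 0 \<degree> Var 0) \<degree> M)"
    using lambda_pi_beta [of "Theta \<degree> Var 0 \<degree> Var 0" M] by (simp add: lambda_pi_sym)
  also have "lambda_pi (Lam (Theta \<degree> Var 0 \<degree> Var 0) \<degree> M) (Lam Omega \<degree> M)"
    by (intro lambda_pi_App lambda_pi_Lam lambda_pi_Theta_Var lambda_pi_refl)
  also have "lambda_pi (Lam Omega \<degree> M) Omega"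
    using lambda_pi_beta [of Omega M] by simp
  finally show ?thesis .
qed

text \<open>
  Lifting at \<open>i\<close> and substitution of \<open>u\<close> for \<open>i\<close> are both families of maps on terms, indexed by \<open>i\<close> and
  by \<open>(u, i)\<close>; \<open>up\<close> is the change of index on passing under a binder.
\<close>

lemma lambda_pi_map:
  assumes "lambda_pi M N"
    and App: "\<And>i s t. f i (s \<degree> t) = f i s \<degree> f i t"
    and Lam: "\<And>i s. f i (Lam s) = Lam (f (up i) s)"
    and Var_0: "\<And>i. f (up i) (Var 0) = Var 0"
    and lift: "\<And>i s. f (up i) (lift s 0) = lift (f i s) 0"
    and subst: "\<And>i s t. f i (subst s t 0) = subst (f (up i) s) (f i t) 0"
  shows "lambda_pi (f i M) (f i N)"
proof -
  have Var_1: "f (up (up i)) (Var (Suc 0)) = Var (Suc 0)" for i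
    using lift [of "up i" "Var 0"] by (simp add: Var_0)
  have closed: "f i Omega = Omega" "f i Theta = Theta" for i
    by (simp_all add: Omega_def Theta_def B_term_def C_term_def App Lam Var_0 Var_1)
  let ?T = "\<lambda>M N. \<forall>i. lambda_pi (f i M) (f i N)"
  have "equivp ?T"
    by (intro equivpI reflpI sympI transpI)
      (simp, blast intro: lambda_pi_sym, blast intro: lambda_pi_trans)
  then have "pi_theory ?T"
    by (auto simp: pi_theory_iff lam_congruence_def beta_rule.simps eta_rule.simps
        App Lam Var_0 lift subst closed lambda_pi_beta lambda_pi_eta lambda_pi_Theta
        intro: lambda_pi_App lambda_pi_Lam)
  with lambda_pi_least assms(1) show ?thesis
    by blast
qed

lemma lambda_pi_lift: "lambda_pi M N \<Longrightarrow> lambda_pi (lift M k) (lift N k)"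
  by (rule lambda_pi_map [of _ _ "\<lambda>i t. lift t i" Suc]) (simp_all add: lift_lift lift_subst)

lemma lambda_pi_subst:
  assumes "lambda_pi M N"
  shows "lambda_pi (subst M u k) (subst N u k)"
  using lambda_pi_map [OF assms, of "\<lambda>(u, k) t. subst t u k" "\<lambda>(u, k). (lift u 0, Suc k)" "(u, k)"]
  by (auto simp: lift_subst_ge subst_subst)

section \<open>The reduction cycle of \<open>\<Theta>\<close>\<close>

lemma G_beta_Theta_eq:
  "G_beta Theta = {B_term \<degree> C_term, C_term \<degree> Lam (Var 0 \<degree> C_term), Lam (Var 0 \<degree> C_term) \<degree> B_term}"
  (is "_ = {?BC, ?CL, ?LB}")
proof -
  have cycle: "beta ?BC t \<longleftrightarrow> t = ?CL" "beta ?CL t \<longleftrightarrow> t = ?LB" "beta ?LB t \<longleftrightarrow> t = ?BC" for t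
    by (auto simp: beta_def B_term_def C_term_def ctxt_closure_iff beta_rule.simps)
  have "t \<in> {?BC, ?CL, ?LB}" if "beta\<^sup>*\<^sup>* ?BC t" for t
    using that by induct (auto simp: cycle)
  moreover have "beta ?BC ?CL" "beta ?CL ?LB"
    by (simp_all only: cycle)
  then have "beta\<^sup>*\<^sup>* ?BC ?CL" "beta\<^sup>*\<^sup>* ?BC ?LB"
    by (blast intro: rtranclp.intros)+
  ultimately show ?thesis
    unfolding G_beta_def Theta_def by blast
qed

lemma Theta_in_G_beta: "Theta \<in> G_beta Theta"
  by (simp add: G_beta_def)

lemma lift_G_beta_Theta: "\<Psi> \<in> G_beta Theta \<Longrightarrow> lift \<Psi> k = \<Psi>"
  and subst_G_beta_Theta: "\<Psi> \<in> G_beta Theta \<Longrightarrow> subst \<Psi> u k = \<Psi>"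
  by (auto simp: G_beta_Theta_eq B_term_def C_term_def)

lemma notin_G_beta_Theta:
  "Var i \<notin> G_beta Theta" "Lam s \<notin> G_beta Theta" "s \<degree> Var i \<notin> G_beta Theta"
  "Var i \<degree> s \<notin> G_beta Theta" "Omega \<notin> G_beta Theta"
  by (auto simp: G_beta_Theta_eq B_term_def C_term_def Omega_def)

inductive_set cyclic_headed :: "lam set" where
  Theta: "\<Psi> \<in> G_beta Theta \<Longrightarrow> \<Psi> \<in> cyclic_headed"
| Omega: "Omega \<in> cyclic_headed"
| App: "s \<in> cyclic_headed \<Longrightarrow> s \<degree> t \<in> cyclic_headed"
| Lam: "s \<in> cyclic_headed \<Longrightarrow> Lam s \<in> cyclic_headed"

lemma cyclic_headed_iff:
  "Var i \<notin> cyclic_headed"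
  "Lam s \<in> cyclic_headed \<longleftrightarrow> s \<in> cyclic_headed"
  "s \<degree> t \<in> cyclic_headed \<longleftrightarrow> s \<in> cyclic_headed \<or> s \<degree> t \<in> G_beta Theta \<or> s \<degree> t = Omega"
  by (subst cyclic_headed.simps; auto simp: notin_G_beta_Theta Omega_def)+

lemma lift_cyclic_headed: "s \<in> cyclic_headed \<Longrightarrow> lift s k \<in> cyclic_headed"
  by (induct arbitrary: k rule: cyclic_headed.induct)
    (auto simp: lift_G_beta_Theta intro: cyclic_headed.intros)

lemma subst_cyclic_headed: "s \<in> cyclic_headed \<Longrightarrow> subst s t k \<in> cyclic_headed"
  by (induct arbitrary: t k rule: cyclic_headed.induct)
    (auto simp: subst_G_beta_Theta intro: cyclic_headed.intros)

lemma eta_body_cyclic_headed: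
  assumes "lift s 0 \<degree> Var 0 \<in> cyclic_headed"
  shows "s \<in> cyclic_headed"
proof -
  have "lift s 0 \<in> cyclic_headed"
    using assms by (auto simp: cyclic_headed_iff notin_G_beta_Theta Omega_def)
  then show ?thesis
    using subst_cyclic_headed [of "lift s 0" "Var 0" 0] by simp
qed

lemma notin_if_subset_cyclic_headed:
  assumes "P \<subseteq> cyclic_headed"
  shows "Var i \<notin> P" "Var i \<degree> s \<notin> P" "s \<notin> cyclic_headed \<Longrightarrow> Lam s \<notin> P"
proof -
  have "Var i \<degree> s \<notin> cyclic_headed"
    by (simp add: cyclic_headed_iff notin_G_beta_Theta Omega_def)
  with assms show "Var i \<notin> P" "Var i \<degree> s \<notin> P" "s \<notin> cyclic_headed \<Longrightarrow> Lam s \<notin> P"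
    using cyclic_headed_iff(1,2) by blast+
qed

lemma beta_eta_Omega_G_beta_Theta:
  assumes "P \<subseteq> cyclic_headed" "\<Psi> \<in> G_beta Theta" "beta_eta_Omega P \<Psi> t"
  shows "t \<in> G_beta Theta \<or> \<Psi> \<in> P \<and> t = Omega"
  using assms(2,3)
  by (auto simp: G_beta_Theta_eq B_term_def C_term_def beta_eta_Omega_iff
      notin_if_subset_cyclic_headed [OF assms(1)] notin_if_subset_cyclic_headed [OF order_refl])

lemma beta_eta_Omega_Omega: "P \<subseteq> cyclic_headed \<Longrightarrow> beta_eta_Omega P Omega t \<Longrightarrow> t = Omega"
  by (auto simp: Omega_def beta_eta_Omega_iff notin_if_subset_cyclic_headed)

lemma beta_eta_Omega_cyclic_headed:
  assumes "s \<in> cyclic_headed" "beta_eta_Omega cyclic_headed s t"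
  shows "t \<in> cyclic_headed"
  using assms
proof (induct arbitrary: t)
  case (Theta \<Psi>)
  then show ?case
    using beta_eta_Omega_G_beta_Theta [OF order_refl] by (blast intro: cyclic_headed.intros)
next
  case Omega
  then show ?case
    using beta_eta_Omega_Omega [OF order_refl] by (blast intro: cyclic_headed.Omega)
next
  case (App s u)
  then show ?case
    by (auto simp: beta_eta_Omega_App_iff cyclic_headed_iff(2)
        intro: cyclic_headed.intros subst_cyclic_headed)
next
  case (Lam s)
  then show ?case
    by (auto simp: beta_eta_Omega_Lam_iff intro: cyclic_headed.intros dest: eta_body_cyclic_headed)
qed

section \<open>Consistency of \<open>\<lambda>\<pi>\<close>\<close>

interpretation cyclic_headed: Omega_contraction cyclic_headed
  by unfold_locales
    (fact lift_cyclic_headed subst_cyclic_headed beta_eta_Omega_cyclic_headed cyclic_headed_iff(1)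
      cyclic_headed.App cyclic_headed.Lam)+

lemma lambda_pi_Var_iff: "lambda_pi (Var i) (Var j) \<longleftrightarrow> i = j"
proof
  assume "lambda_pi (Var i) (Var j)"
  moreover have "lambda_pi \<le> equivclp (beta_eta_Omega cyclic_headed)"
    by (intro lambda_pi_least pi_theory_equivclp_beta_eta_Omega cyclic_headed.intros
        Theta_in_G_beta)
  ultimately have "equivclp (beta_eta_Omega cyclic_headed) (Var i) (Var j)"
    by blast
  then obtain u where reducts: "(beta_eta_Omega cyclic_headed)\<^sup>*\<^sup>* (Var i) u"
      "(beta_eta_Omega cyclic_headed)\<^sup>*\<^sup>* (Var j) u"
    by (rule confluentp_equivclpE [OF cyclic_headed.confluentp_beta_eta_Omega])
  have normal: "u = Var k" if "(beta_eta_Omega cyclic_headed)\<^sup>*\<^sup>* (Var k) u" for k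
    using that
    by (cases rule: converse_rtranclpE) (auto simp: beta_eta_Omega_Var_iff cyclic_headed_iff(1))
  show "i = j"
    using reducts [THEN normal] by simp
qed simp

lemma lambda_pi_lift_neq_Var: "\<not> lambda_pi (lift M k) (Var k)"
proof
  assume "lambda_pi (lift M k) (Var k)"
  then have "lambda_pi M (Var i)" for i
    using lambda_pi_subst [of "lift M k" "Var k" "Var i" k] by simp
  then have "lambda_pi (Var 0) (Var 1)"
    using lambda_pi_sym lambda_pi_trans by blast
  then show False
    by (simp add: lambda_pi_Var_iff)
qed

section \<open>\<open>\<beta>\<eta>\<pi>\<close>-reduction\<close>

lemma lambda_pi_G_beta_Theta:
  assumes "\<Psi> \<in> G_beta Theta"
  shows "lambda_pi Theta \<Psi>"
proof -
  have "equivclp beta Theta \<Psi>"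
    using assms by (simp add: G_beta_def rtranclp_into_equivclp)
  moreover have "equivclp beta \<le> lambda_pi"
    by (simp add: beta_def equivclp_ctxt_closure_le_iff lam_congruence_lambda_pi beta_rule_lambda_pi)
  ultimately show ?thesis
    by blast
qed

lemma pi_rule_lambda_pi: "pi_rule \<le> lambda_pi"
proof (rule predicate2I)
  fix s t
  assume "pi_rule s t"
  then show "lambda_pi s t"
  proof cases
    case contraction: (1 \<Psi> M N)
    then have "lambda_pi \<Psi> Theta" "lambda_pi N M"
      by (simp_all add: lambda_pi_G_beta_Theta lambda_pi_sym)
    then have "lambda_pi (\<Psi> \<degree> M \<degree> N) (Theta \<degree> M \<degree> M)"
      by (intro lambda_pi_App lambda_pi_refl)
    also have "lambda_pi (Theta \<degree> M \<degree> M) Omega"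
      by (rule lambda_pi_Theta)
    finally show ?thesis
      using contraction by simp
  qed
qed

lemma beta_eta_pi_lambda_pi:
  assumes "beta_eta_pi s t"
  shows "lambda_pi s t"
proof -
  have "equivclp beta_eta_pi \<le> lambda_pi"
    by (simp add: beta_eta_pi_def equivclp_ctxt_closure_le_iff lam_congruence_lambda_pi
        beta_rule_lambda_pi eta_rule_lambda_pi pi_rule_lambda_pi)
  with assms show ?thesis
    by blast
qed

text \<open>
  Adding \<^const>\<open>Omega\<close> does not change the reduction, as \<^const>\<open>Omega\<close> is its own \<open>\<beta>\<close>-reduct.
\<close>

definition pi_redexes :: "lam set" where
  "pi_redexes = {\<Psi> \<degree> M \<degree> N | \<Psi> M N. \<Psi> \<in> G_beta Theta \<and> lambda_pi M N} \<union> {Omega}"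

lemma beta_eta_Omega_pi_redexes: "beta_eta_Omega pi_redexes = beta_eta_pi"
proof -
  have "beta_rule Omega Omega"
    using beta_rule.intros [of "Var 0 \<degree> Var 0" "Lam (Var 0 \<degree> Var 0)"] by (simp add: Omega_def)
  then have "sup beta_rule (sup eta_rule (\<lambda>s t. s \<in> pi_redexes \<and> t = Omega))
      = sup beta_rule (sup eta_rule pi_rule)"
    by (intro ext) (auto simp: pi_redexes_def pi_rule.simps)
  then show ?thesis
    by (simp add: beta_eta_Omega_def beta_eta_pi_def)
qed

lemma pi_redexes_subset_cyclic_headed: "pi_redexes \<subseteq> cyclic_headed"
  by (auto simp: pi_redexes_def intro: cyclic_headed.intros)

lemma lift_pi_redexes: "s \<in> pi_redexes \<Longrightarrow> lift s k \<in> pi_redexes"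
  by (auto simp: pi_redexes_def lift_G_beta_Theta intro: lambda_pi_lift)

lemma subst_pi_redexes: "s \<in> pi_redexes \<Longrightarrow> subst s t k \<in> pi_redexes"
  by (auto simp: pi_redexes_def subst_G_beta_Theta intro: lambda_pi_subst)

lemma eta_body_notin_pi_redexes: "lift s 0 \<degree> Var 0 \<notin> pi_redexes"
  by (auto simp: pi_redexes_def lift_eq_App_iff lambda_pi_lift_neq_Var Omega_def)

lemma pi_redexes_App_iff:
  assumes "\<Psi> \<in> G_beta Theta"
  shows "\<Psi> \<degree> M \<degree> N \<in> pi_redexes \<longleftrightarrow> lambda_pi M N"
  using assms by (auto simp: pi_redexes_def Omega_def)

lemma notin_pi_redexes:
  "Var i \<notin> pi_redexes" "Lam s \<notin> pi_redexes"
  "\<Psi> \<in> G_beta Theta \<Longrightarrow> \<Psi> \<notin> pi_redexes"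
  "\<Psi> \<in> G_beta Theta \<Longrightarrow> \<Psi> \<degree> M \<notin> pi_redexes"
  by (auto simp: pi_redexes_def G_beta_Theta_eq B_term_def C_term_def Omega_def)

lemma beta_eta_pi_Omega: "beta_eta_pi Omega t \<Longrightarrow> t = Omega"
  using beta_eta_Omega_Omega [OF pi_redexes_subset_cyclic_headed]
  by (simp add: beta_eta_Omega_pi_redexes)

lemma beta_eta_pi_G_beta_Theta: "\<Psi> \<in> G_beta Theta \<Longrightarrow> beta_eta_pi \<Psi> t \<Longrightarrow> t \<in> G_beta Theta"
  using beta_eta_Omega_G_beta_Theta [OF pi_redexes_subset_cyclic_headed]
  by (auto simp: beta_eta_Omega_pi_redexes notin_pi_redexes)

lemma beta_eta_pi_G_beta_Theta_AppE:
  assumes "\<Psi> \<in> G_beta Theta" "beta_eta_pi (\<Psi> \<degree> M \<degree> N) t"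
  obtains (inner) \<Psi>' M' N' where "t = \<Psi>' \<degree> M' \<degree> N'" "\<Psi>' \<in> G_beta Theta"
      "lambda_pi M' N' \<longleftrightarrow> lambda_pi M N"
    | (contract) "t = Omega" "lambda_pi M N"
proof -
  have "\<Psi> \<noteq> Lam r" for r
    using assms(1) notin_G_beta_Theta by auto
  then consider (head) \<Psi>' where "t = \<Psi>' \<degree> M \<degree> N" "beta_eta_pi \<Psi> \<Psi>'"
    | (left) M' where "t = \<Psi> \<degree> M' \<degree> N" "beta_eta_pi M M'"
    | (right) N' where "t = \<Psi> \<degree> M \<degree> N'" "beta_eta_pi N N'"
    | (root) "t = Omega" "lambda_pi M N"
    using assms notin_pi_redexes(4) pi_redexes_App_iff [OF assms(1)]
    unfolding beta_eta_Omega_pi_redexes [symmetric] beta_eta_Omega_App_iff by blast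
  then show thesis
  proof cases
    case head
    with assms(1) inner show ?thesis
      by (auto intro: beta_eta_pi_G_beta_Theta)
  next
    case left
    with assms(1) inner show ?thesis
      by (blast dest: beta_eta_pi_lambda_pi intro: lambda_pi_sym lambda_pi_trans)
  next
    case right
    with assms(1) inner show ?thesis
      by (blast dest: beta_eta_pi_lambda_pi intro: lambda_pi_sym lambda_pi_trans)
  qed (rule contract)
qed

lemma beta_eta_pi_pi_redexes:
  assumes "s \<in> pi_redexes" "beta_eta_pi s t"
  shows "t \<in> pi_redexes"
proof -
  from assms(1) consider (Omega) "s = Omega"
    | (pi_redex) \<Psi> M N where "s = \<Psi> \<degree> M \<degree> N" "\<Psi> \<in> G_beta Theta" "lambda_pi M N"
    by (auto simp: pi_redexes_def)
  then show ?thesis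
  proof cases
    case Omega
    with assms show ?thesis
      by (auto dest: beta_eta_pi_Omega)
  next
    case (pi_redex \<Psi> M N)
    from pi_redex(2) assms(2) [unfolded pi_redex(1)] show ?thesis
      by (cases rule: beta_eta_pi_G_beta_Theta_AppE)
        (use pi_redex(3) in \<open>auto simp: pi_redexes_App_iff pi_redexes_def\<close>)
  qed
qed

interpretation pi_redexes: Omega_contraction pi_redexes
  by unfold_locales
    (auto simp: beta_eta_Omega_pi_redexes eta_body_notin_pi_redexes notin_pi_redexes
      intro: lift_pi_redexes subst_pi_redexes beta_eta_pi_pi_redexes)

lemma confluentp_beta_eta_pi: "confluentp beta_eta_pi"
  using pi_redexes.confluentp_beta_eta_Omega by (simp add: beta_eta_Omega_pi_redexes)

lemma equivclp_beta_eta_pi_Omega_iff: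
  "equivclp beta_eta_pi s Omega \<longleftrightarrow> beta_eta_pi\<^sup>*\<^sup>* s Omega"
proof
  assume "equivclp beta_eta_pi s Omega"
  with confluentp_beta_eta_pi obtain u where "beta_eta_pi\<^sup>*\<^sup>* s u" "beta_eta_pi\<^sup>*\<^sup>* Omega u"
    by (rule confluentp_equivclpE)
  moreover from this(2) have "u = Omega"
    by induct (auto dest: beta_eta_pi_Omega)
  ultimately show "beta_eta_pi\<^sup>*\<^sup>* s Omega"
    by simp
qed (rule rtranclp_into_equivclp)

lemma rtranclp_beta_eta_pi_Omega_iff:
  assumes "\<Psi> \<in> G_beta Theta"
  shows "beta_eta_pi\<^sup>*\<^sup>* (\<Psi> \<degree> M \<degree> N) Omega \<longleftrightarrow> lambda_pi M N"
proof
  assume "beta_eta_pi\<^sup>*\<^sup>* (\<Psi> \<degree> M \<degree> N) Omega"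
  then show "lambda_pi M N"
    using assms
  proof (induct "\<Psi> \<degree> M \<degree> N" arbitrary: \<Psi> M N rule: converse_rtranclp_induct)
    case base
    then show ?case
      by (simp add: Omega_def)
  next
    case (step t)
    from step.prems step.hyps(1) show ?case
      by (cases rule: beta_eta_pi_G_beta_Theta_AppE) (use step.hyps(3) in auto)
  qed
next
  assume "lambda_pi M N"
  with assms have "pi_rule (\<Psi> \<degree> M \<degree> N) Omega"
    by (rule pi_rule.intros)
  then have "beta_eta_pi (\<Psi> \<degree> M \<degree> N) Omega"
    by (simp add: beta_eta_pi_def ctxt_closure.base)
  then show "beta_eta_pi\<^sup>*\<^sup>* (\<Psi> \<degree> M \<degree> N) Omega" ..
qed

theorem theorem2p5:
  shows "confluentp beta_eta_pi \<and>
    (\<forall>M N. equivclp beta_eta_pi (Theta \<degree> M \<degree> N) Omega \<longleftrightarrow> lambda_pi M N)"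
proof (intro conjI allI)
  show "confluentp beta_eta_pi"
    by (rule confluentp_beta_eta_pi)
  fix M N
  have "equivclp beta_eta_pi (Theta \<degree> M \<degree> N) Omega \<longleftrightarrow> beta_eta_pi\<^sup>*\<^sup>* (Theta \<degree> M \<degree> N) Omega"
    by (rule equivclp_beta_eta_pi_Omega_iff)
  also have "\<dots> \<longleftrightarrow> lambda_pi M N"
    using Theta_in_G_beta by (rule rtranclp_beta_eta_pi_Omega_iff)
  finally show "equivclp beta_eta_pi (Theta \<degree> M \<degree> N) Omega \<longleftrightarrow> lambda_pi M N" .
qed

end
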